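(* Let $(\mathfrak{g},\triangleright)$ be a pre-Lie algebra over $\mathbb{R}$. If $(\bar\pi_t,\bar\omega_t)$ and $(\pi_t,\omega_t)$ are two equivalent formal post-Lie deformations of $(\mathfrak{g},\triangleright)$, then their infinitesimals $(\bar\pi_1,\bar\omega_1)$ and $(\pi_1,\omega_1)$ are in the same cohomology class in $\mathcal{H}^2_{\mathsf{PL}}(\mathfrak{g};\mathfrak{g})$.
   Context: A post-Lie algebra $(\mathfrak{g},[\cdot,\cdot],\triangleright)$ is a Lie algebra $(\mathfrak{g},[\cdot,\cdot])$ with a bilinear product $\triangleright$ such that $x\triangleright[y,z]=[x\triangleright y,z]+[y,x\triangleright z]$ and $([x,y]+x\triangleright y-y\triangleright x)\triangleright z=x\triangleright(y\triangleright z)-y\triangleright(x\triangleright z)$. A pre-Lie algebra $(\mathfrak{g},\triangleright)$ is a post-Lie algebra with zero bracket. **Formal deformations.** Let $(\mathfrak{g},\triangleright)$ be a pre-Lie algebra over $\mathbb{R}$. Let $\pi_t=\sum_{i\ge0}\pi_it^i$ and $\omega_t=\sum_{i\ge0}\omega_it^i$ with $\pi_i\in\mathrm{Hom}_{\mathbb{R}}(\wedge^2\mathfrak{g},\mathfrak{g})$, $\omega_i\in\mathrm{Hom}_{\mathbb{R}}(\mathfrak{g}\otimes\mathfrak{g},\mathfrak{g})$, extended to $\mathfrak{g}[[t]]$ by $\big(\sum_jx_jt^j,\sum_ky_kt^k\big)\mapsto\sum_{i,j,k}\pi_i(x_j,y_k)t^{i+j+k}$ (and likewise for $\omega_t$).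 The pair $(\pi_t,\omega_t)$ is a formal post-Lie deformation of $(\mathfrak{g},\triangleright)$ if $(\mathfrak{g}[[t]],\pi_t,\omega_t)$ is an $\mathbb{R}[[t]]$-post-Lie algebra (with Lie bracket $\pi_t$ and product $\omega_t$) and $(\pi_0,\omega_0)=(0,\triangleright)$. Its infinitesimal is $(\pi_1,\omega_1)$; this is a $2$-cocycle in the complex below. **Equivalence.** A formal isomorphism from $(\bar\pi_t,\bar\omega_t)$ to $(\pi_t,\omega_t)$ is a power series $\Phi_t=\sum_{i\ge0}\phi_it^i:\mathfrak{g}[[t]]\to\mathfrak{g}[[t]]$ with $\phi_i\in\mathrm{Hom}_{\mathbb{R}}(\mathfrak{g},\mathfrak{g})$, $\phi_0=\mathrm{Id}$, such that $\Phi_t\circ\bar\pi_t=\pi_t\circ(\Phi_t\times\Phi_t)$ and $\Phi_t\circ\bar\omega_t=\omega_t\circ(\Phi_t\times\Phi_t)$. Two formal post-Lie deformations are equivalent if there is a formal isomorphism from one to the other. **Cohomology in low degree.** The post-Lie cochain complex of $(\mathfrak{g},\triangleright)$ has $\mathfrak{C}^1_{\mathsf{PL}}(\mathfrak{g};\mathfrak{g})=\mathrm{Hom}(\mathfrak{g},\mathfrak{g})$ and $\mathfrak{C}^2_{\mathsf{PL}}(\mathfrak{g};\mathfrak{g})=\mathrm{Hom}(\wedge^2\mathfrak{g},\mathfrak{g})\oplus\mathrm{Hom}(\mathfrak{g}\otimes\mathfrak{g},\mathfrak{g})$. For $\phi\in\mathfrak{C}^1_{\mathsf{PL}}(\mathfrak{g};\mathfrak{g})$,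 $\partial\phi=(0,(x,y)\mapsto\phi(x)\triangleright y+x\triangleright\phi(y)-\phi(x\triangleright y))$. For $(\pi,\omega)\in\mathfrak{C}^2_{\mathsf{PL}}(\mathfrak{g};\mathfrak{g})$, $\partial(\pi,\omega)$ has the components (zero in $\mathrm{Hom}(\wedge^3\mathfrak{g},\mathfrak{g})$) $$\partial(\pi,\omega)_1(x;y,z)=x\triangleright\pi(y,z)-\pi(x\triangleright y,z)+\pi(x\triangleright z,y),$$ $$\partial(\pi,\omega)_2(x,y;z)=-\big(\omega(x,y)-\omega(y,x)+\pi(x,y)\big)\triangleright z-\omega(x\triangleright y-y\triangleright x,z)+\omega(x,y\triangleright z)+x\triangleright\omega(y,z)-\omega(y,x\triangleright z)-y\triangleright\omega(x,z).$$ $\mathcal{H}^2_{\mathsf{PL}}(\mathfrak{g};\mathfrak{g})$ is the space of $2$-cocycles $\{(\pi,\omega):\partial(\pi,\omega)=0\}$ modulo $\partial(\mathfrak{C}^1_{\mathsf{PL}}(\mathfrak{g};\mathfrak{g}))$. *)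

theory Defs
  imports
    "HOL-Computational_Algebra.Formal_Power_Series"
    "HOL-Library.Function_Algebras"
    "HOL-Library.Product_Plus"
begin

section \<open>Lie, post-Lie and pre-Lie algebras over a commutative ring\<close>

definition module_bilinear ::
  "('r::comm_ring_1 \<Rightarrow> 'm::ab_group_add \<Rightarrow> 'm) \<Rightarrow> ('m \<Rightarrow> 'm \<Rightarrow> 'm) \<Rightarrow> bool" where
  "module_bilinear s f \<longleftrightarrow>
     (\<forall>x. module_hom s s (\<lambda>y. f x y)) \<and> (\<forall>y. module_hom s s (\<lambda>x. f x y))"

locale lie_algebra = module scale
  for scale :: "'r::comm_ring_1 \<Rightarrow> 'm::ab_group_add \<Rightarrow> 'm" +
  fixes bracket :: "'m \<Rightarrow> 'm \<Rightarrow> 'm"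
  assumes bracket_bilinear: "module_bilinear scale bracket"
    and bracket_alternating: "bracket x x = 0"
    and jacobi: "bracket x (bracket y z) + bracket y (bracket z x) + bracket z (bracket x y) = 0"

locale post_lie_algebra = lie_algebra scale bracket
  for scale :: "'r::comm_ring_1 \<Rightarrow> 'm::ab_group_add \<Rightarrow> 'm"
    and bracket :: "'m \<Rightarrow> 'm \<Rightarrow> 'm" +
  fixes prd :: "'m \<Rightarrow> 'm \<Rightarrow> 'm"  (infixl "\<rhd>" 75)
  assumes prd_bilinear: "module_bilinear scale (\<rhd>)"
    and prd_derivation: "x \<rhd> bracket y z = bracket (x \<rhd> y) z + bracket y (x \<rhd> z)"
    and prd_bracket: "(bracket x y + x \<rhd> y - y \<rhd> x) \<rhd> z = x \<rhd> (y \<rhd> z) - y \<rhd> (x \<rhd> z)"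

definition pre_lie_algebra ::
  "('r::comm_ring_1 \<Rightarrow> 'm::ab_group_add \<Rightarrow> 'm) \<Rightarrow> ('m \<Rightarrow> 'm \<Rightarrow> 'm) \<Rightarrow> bool" where
  "pre_lie_algebra scale prd \<longleftrightarrow> post_lie_algebra scale (\<lambda>x y. 0) prd"


section \<open>Formal power series with coefficients in a real vector space\<close>

text \<open>For a real vector space \<open>'g\<close>, the type \<open>'g fps\<close> is the module \<open>\<gg>[[t]]\<close> over the ring
  \<open>real fps\<close>. Series of (multi)linear maps are given by their coefficient sequences.\<close>

definition fps_scale :: "real fps \<Rightarrow> 'g::real_vector fps \<Rightarrow> 'g fps" where
  "fps_scale r x = Abs_fps (\<lambda>n. \<Sum>i=0..n. fps_nth r i *\<^sub>R fps_nth x (n - i))"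

definition linear_ext :: "(nat \<Rightarrow> 'g \<Rightarrow> 'g) \<Rightarrow> 'g::real_vector fps \<Rightarrow> 'g fps" where
  "linear_ext \<phi> x = Abs_fps (\<lambda>n. \<Sum>(i, j) \<in> {(i, j). i + j = n}. \<phi> i (fps_nth x j))"

definition bilinear_ext ::
  "(nat \<Rightarrow> 'g \<Rightarrow> 'g \<Rightarrow> 'g) \<Rightarrow> 'g::real_vector fps \<Rightarrow> 'g fps \<Rightarrow> 'g fps" where
  "bilinear_ext f x y =
     Abs_fps (\<lambda>n. \<Sum>(i, j, k) \<in> {(i, j, k). i + j + k = n}. f i (fps_nth x j) (fps_nth y k))"

lemma module_fps_scale: "module (fps_scale :: real fps \<Rightarrow> 'g::real_vector fps \<Rightarrow> 'g fps)"
proof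
  fix a b :: "real fps" and x y :: "'g fps"
  show "fps_scale a (x + y) = fps_scale a x + fps_scale a y"
    by (rule fps_ext) (simp add: fps_scale_def scaleR_add_right sum.distrib)
  show "fps_scale (a + b) x = fps_scale a x + fps_scale b x"
    by (rule fps_ext) (simp add: fps_scale_def scaleR_add_left sum.distrib)
  show "fps_scale a (fps_scale b x) = fps_scale (a * b) x"
  proof (rule fps_ext)
    fix n
    have "(\<Sum>j=0..n. \<Sum>i=0..j. (fps_nth a i * fps_nth b (j - i)) *\<^sub>R fps_nth x (n - j)) =
          (\<Sum>j=0..n. \<Sum>i=0..n - j. (fps_nth a j * fps_nth b i) *\<^sub>R fps_nth x (n - j - i))"
      by (rule fps_mult_assoc_lemma)
    then show "fps_nth (fps_scale a (fps_scale b x)) n = fps_nth (fps_scale (a * b) x) n"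
      by (simp add: fps_scale_def fps_mult_nth scaleR_sum_left scaleR_sum_right)
  qed
  show "fps_scale 1 x = x"
  proof (rule fps_ext)
    fix n
    have "(\<Sum>i=0..n. fps_nth 1 i *\<^sub>R fps_nth x (n - i)) =
          (\<Sum>i=0..n. if i = 0 then fps_nth x n else 0)"
      by (rule sum.cong) auto
    then show "fps_nth (fps_scale 1 x) n = fps_nth x n"
      by (simp add: fps_scale_def)
  qed
qed


section \<open>Cochains, formal deformations and cohomology in low degree\<close>

definition PL_cochains1 :: "('g::real_vector \<Rightarrow> 'g) set" where
  "PL_cochains1 = {\<phi>. linear \<phi>}"

definition PL_cochains2 ::
  "(('g::real_vector \<Rightarrow> 'g \<Rightarrow> 'g) \<times> ('g \<Rightarrow> 'g \<Rightarrow> 'g)) set" where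
  "PL_cochains2 = {(\<pi>, \<omega>). module_bilinear scaleR \<pi> \<and> (\<forall>x. \<pi> x x = 0) \<and>
                           module_bilinear scaleR \<omega>}"

context
  fixes prd :: "'g::real_vector \<Rightarrow> 'g \<Rightarrow> 'g"  (infixl "\<rhd>" 75)
begin

definition formal_post_lie_deformation ::
  "(nat \<Rightarrow> 'g \<Rightarrow> 'g \<Rightarrow> 'g) \<Rightarrow> (nat \<Rightarrow> 'g \<Rightarrow> 'g \<Rightarrow> 'g) \<Rightarrow> bool" where
  "formal_post_lie_deformation \<pi> \<omega> \<longleftrightarrow>
     (\<forall>i. (\<pi> i, \<omega> i) \<in> PL_cochains2) \<and>
     post_lie_algebra fps_scale (bilinear_ext \<pi>) (bilinear_ext \<omega>) \<and>
     \<pi> 0 = (\<lambda>x y. 0) \<and> \<omega> 0 = (\<rhd>)"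

definition PL_coboundary1 ::
  "('g \<Rightarrow> 'g) \<Rightarrow> ('g \<Rightarrow> 'g \<Rightarrow> 'g) \<times> ('g \<Rightarrow> 'g \<Rightarrow> 'g)" where
  "PL_coboundary1 \<phi> = ((\<lambda>x y. 0), (\<lambda>x y. \<phi> x \<rhd> y + x \<rhd> \<phi> y - \<phi> (x \<rhd> y)))"

text \<open>The first component is the one with three alternating arguments; the other two are
  \<open>\<partial>(\<pi>, \<omega>)\<^sub>1(x; y, z)\<close> and \<open>\<partial>(\<pi>, \<omega>)\<^sub>2(x, y; z)\<close>.\<close>

definition PL_coboundary2 ::
  "('g \<Rightarrow> 'g \<Rightarrow> 'g) \<times> ('g \<Rightarrow> 'g \<Rightarrow> 'g) \<Rightarrow>
   ('g \<Rightarrow> 'g \<Rightarrow> 'g \<Rightarrow> 'g) \<times> ('g \<Rightarrow> 'g \<Rightarrow> 'g \<Rightarrow> 'g) \<times> ('g \<Rightarrow> 'g \<Rightarrow> 'g \<Rightarrow> 'g)" where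
  "PL_coboundary2 = (\<lambda>(\<pi>, \<omega>).
     ((\<lambda>x y z. 0),
      (\<lambda>x y z. x \<rhd> \<pi> y z - \<pi> (x \<rhd> y) z + \<pi> (x \<rhd> z) y),
      (\<lambda>x y z. - ((\<omega> x y - \<omega> y x + \<pi> x y) \<rhd> z) - \<omega> (x \<rhd> y - y \<rhd> x) z
                + \<omega> x (y \<rhd> z) + x \<rhd> \<omega> y z - \<omega> y (x \<rhd> z) - y \<rhd> \<omega> x z)))"

definition PL_cocycles2 :: "(('g \<Rightarrow> 'g \<Rightarrow> 'g) \<times> ('g \<Rightarrow> 'g \<Rightarrow> 'g)) set" where
  "PL_cocycles2 = {c \<in> PL_cochains2. PL_coboundary2 c = 0}"

definition PL_boundaries2 :: "(('g \<Rightarrow> 'g \<Rightarrow> 'g) \<times> ('g \<Rightarrow> 'g \<Rightarrow> 'g)) set" where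
  "PL_boundaries2 = PL_coboundary1 ` PL_cochains1"

definition PL_cohomologous2 ::
  "((('g \<Rightarrow> 'g \<Rightarrow> 'g) \<times> ('g \<Rightarrow> 'g \<Rightarrow> 'g)) \<times> (('g \<Rightarrow> 'g \<Rightarrow> 'g) \<times> ('g \<Rightarrow> 'g \<Rightarrow> 'g))) set" where
  "PL_cohomologous2 = {(c, c') \<in> PL_cocycles2 \<times> PL_cocycles2. c - c' \<in> PL_boundaries2}"

definition PL_cohomology2 :: "(('g \<Rightarrow> 'g \<Rightarrow> 'g) \<times> ('g \<Rightarrow> 'g \<Rightarrow> 'g)) set set" where
  "PL_cohomology2 = PL_cocycles2 // PL_cohomologous2"

end

definition infinitesimal ::
  "(nat \<Rightarrow> 'g \<Rightarrow> 'g \<Rightarrow> 'g) \<Rightarrow> (nat \<Rightarrow> 'g \<Rightarrow> 'g \<Rightarrow> 'g) \<Rightarrow> ('g \<Rightarrow> 'g \<Rightarrow> 'g) \<times> ('g \<Rightarrow> 'g \<Rightarrow> 'g)" where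
  "infinitesimal \<pi> \<omega> = (\<pi> 1, \<omega> 1)"

definition formal_isomorphism ::
  "(nat \<Rightarrow> 'g::real_vector \<Rightarrow> 'g) \<Rightarrow>
   (nat \<Rightarrow> 'g \<Rightarrow> 'g \<Rightarrow> 'g) \<times> (nat \<Rightarrow> 'g \<Rightarrow> 'g \<Rightarrow> 'g) \<Rightarrow>
   (nat \<Rightarrow> 'g \<Rightarrow> 'g \<Rightarrow> 'g) \<times> (nat \<Rightarrow> 'g \<Rightarrow> 'g \<Rightarrow> 'g) \<Rightarrow> bool" where
  "formal_isomorphism \<phi> = (\<lambda>(\<pi>', \<omega>') (\<pi>, \<omega>).
     (\<forall>i. linear (\<phi> i)) \<and> \<phi> 0 = id \<and>
     (\<forall>x y. linear_ext \<phi> (bilinear_ext \<pi>' x y) =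
            bilinear_ext \<pi> (linear_ext \<phi> x) (linear_ext \<phi> y)) \<and>
     (\<forall>x y. linear_ext \<phi> (bilinear_ext \<omega>' x y) =
            bilinear_ext \<omega> (linear_ext \<phi> x) (linear_ext \<phi> y)))"

definition equivalent_deformations ::
  "(nat \<Rightarrow> 'g::real_vector \<Rightarrow> 'g \<Rightarrow> 'g) \<times> (nat \<Rightarrow> 'g \<Rightarrow> 'g \<Rightarrow> 'g) \<Rightarrow>
   (nat \<Rightarrow> 'g \<Rightarrow> 'g \<Rightarrow> 'g) \<times> (nat \<Rightarrow> 'g \<Rightarrow> 'g \<Rightarrow> 'g) \<Rightarrow> bool" where
  "equivalent_deformations D' D \<longleftrightarrow>
     (\<exists>\<phi>. formal_isomorphism \<phi> D' D) \<or> (\<exists>\<phi>. formal_isomorphism \<phi> D D')"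

lemma pre_lie_algebra_linear:
  assumes "pre_lie_algebra scaleR prd"
  shows "linear (prd x)" "linear (\<lambda>x. prd x y)"
proof -
  interpret post_lie_algebra scaleR "\<lambda>x y. 0" prd
    using assms by (simp add: pre_lie_algebra_def)
  show "linear (prd x)" "linear (\<lambda>x. prd x y)"
    using prd_bilinear
    by (simp_all add: module_bilinear_def Real_Vector_Spaces.linear_def Vector_Spaces.linear_def
        module_hom_def real_vector.vector_space_axioms)
qed

lemma PL_boundaries2_subset_cocycles2:
  assumes "pre_lie_algebra scaleR prd"
  shows "PL_boundaries2 prd \<subseteq> PL_cocycles2 prd"
proof
  fix c assume "c \<in> PL_boundaries2 prd"
  then obtain \<phi> where \<phi>: "linear \<phi>" and c: "c = PL_coboundary1 prd \<phi>"
    by (auto simp: PL_boundaries2_def PL_cochains1_def)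
  interpret post_lie_algebra scaleR "\<lambda>x y. 0" prd
    using assms by (simp add: pre_lie_algebra_def)
  note l = pre_lie_algebra_linear[OF assms]
  note s = linear_add[OF l(1)] linear_diff[OF l(1)] linear_scale[OF l(1)] linear_0[OF l(1)]
    linear_add[OF l(2)] linear_diff[OF l(2)] linear_scale[OF l(2)] linear_0[OF l(2)]
    linear_add[OF \<phi>] linear_diff[OF \<phi>] linear_scale[OF \<phi>] linear_0[OF \<phi>]
  have pl: "prd (prd x y) z = prd (prd y x) z + prd x (prd y z) - prd y (prd x z)" for x y z
    using prd_bracket[of x y z] by (simp add: s algebra_simps)
  have "\<phi> (prd (prd x y) z) = \<phi> (prd (prd y x) z) + \<phi> (prd x (prd y z)) - \<phi> (prd y (prd x z))"
    for x y z
    by (subst pl) (simp add: s)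
  note p = this
  define \<omega> where "\<omega> x y = prd (\<phi> x) y + prd x (\<phi> y) - \<phi> (prd x y)" for x y
  have "- prd (\<omega> x y - \<omega> y x) z - \<omega> (prd x y - prd y x) z + \<omega> x (prd y z)
          + prd x (\<omega> y z) - \<omega> y (prd x z) - prd y (\<omega> x z) = 0" for x y z
    unfolding \<omega>_def
    by (simp only: s p[of x y z] pl[of "\<phi> x" y z] pl[of x "\<phi> y" z] pl[of x y "\<phi> z"])
       (simp add: algebra_simps)
  then have "PL_coboundary2 prd c = 0"
    by (simp add: PL_coboundary2_def PL_coboundary1_def c zero_prod_def fun_eq_iff s \<omega>_def)
  moreover have "c \<in> PL_cochains2"
    unfolding c PL_coboundary1_def PL_cochains2_def module_bilinear_def
    by (auto intro!: module_hom.intro module_hom_axioms.intro module_axioms simp: s algebra_simps)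
  ultimately show "c \<in> PL_cocycles2 prd"
    by (simp add: PL_cocycles2_def)
qed

lemma equiv_PL_cohomologous2:
  assumes "pre_lie_algebra scaleR prd"
  shows "equiv (PL_cocycles2 prd) (PL_cohomologous2 prd)"
proof -
  note l = pre_lie_algebra_linear[OF assms]
  note s = linear_add[OF l(1)] linear_neg[OF l(1)] linear_0[OF l(1)]
    linear_add[OF l(2)] linear_neg[OF l(2)] linear_0[OF l(2)]
  have zero: "0 \<in> PL_boundaries2 prd"
    unfolding PL_boundaries2_def PL_cochains1_def
    by (rule image_eqI[of _ _ "\<lambda>x. 0"])
       (auto simp: PL_coboundary1_def zero_prod_def fun_eq_iff s module_hom_zero)
  have add: "b + b' \<in> PL_boundaries2 prd"
    if "b \<in> PL_boundaries2 prd" "b' \<in> PL_boundaries2 prd" for b b'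
  proof -
    from that obtain \<phi> \<psi> where "linear \<phi>" "b = PL_coboundary1 prd \<phi>"
      "linear \<psi>" "b' = PL_coboundary1 prd \<psi>"
      by (auto simp: PL_boundaries2_def PL_cochains1_def)
    then show ?thesis
      unfolding PL_boundaries2_def PL_cochains1_def
      by (intro image_eqI[of _ _ "\<lambda>x. \<phi> x + \<psi> x"])
         (auto simp: PL_coboundary1_def fun_eq_iff s linear_compose_add)
  qed
  have neg: "- b \<in> PL_boundaries2 prd" if "b \<in> PL_boundaries2 prd" for b
  proof -
    from that obtain \<phi> where "linear \<phi>" "b = PL_coboundary1 prd \<phi>"
      by (auto simp: PL_boundaries2_def PL_cochains1_def)
    then show ?thesis
      unfolding PL_boundaries2_def PL_cochains1_def
      by (intro image_eqI[of _ _ "\<lambda>x. - \<phi> x"])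
         (auto simp: PL_coboundary1_def fun_eq_iff s linear_compose_neg)
  qed
  show ?thesis
  proof (rule equivI)
    show "PL_cohomologous2 prd \<subseteq> PL_cocycles2 prd \<times> PL_cocycles2 prd"
      by (auto simp: PL_cohomologous2_def)
    show "refl_on (PL_cocycles2 prd) (PL_cohomologous2 prd)"
      using zero by (auto simp: refl_on_def PL_cohomologous2_def simp flip: zero_prod_def)
    show "sym (PL_cohomologous2 prd)"
    proof (rule symI)
      fix c d assume "(c, d) \<in> PL_cohomologous2 prd"
      then show "(d, c) \<in> PL_cohomologous2 prd"
        using neg[of "c - d"] unfolding PL_cohomologous2_def minus_diff_eq by blast
    qed
    show "trans (PL_cohomologous2 prd)"
    proof (rule transI)
      fix c d e assume *: "(c, d) \<in> PL_cohomologous2 prd" "(d, e) \<in> PL_cohomologous2 prd"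
      have "c - e = (c - d) + (d - e)" by simp
      then show "(c, e) \<in> PL_cohomologous2 prd"
        using * add[of "c - d" "d - e"] unfolding PL_cohomologous2_def by auto
    qed
  qed
qed

end

theory Submission
  imports Defs
begin

text \<open>Everything is read off from the coefficients of \<open>t\<close> on constant series: the post-Lie
  identities give that an infinitesimal is a 2-cocycle, and compatibility of
  \<open>\<Phi>\<^sub>t = id + \<phi>\<^sub>1 t + \<dots>\<close> with the structures gives that the two infinitesimals
  differ by the coboundary of \<open>\<phi>\<^sub>1\<close>.\<close>

lemma linear_ext_nth_0: "fps_nth (linear_ext \<phi> x) 0 = \<phi> 0 (fps_nth x 0)"
proof -
  have "{(i, j). i + j = (0::nat)} = {(0, 0)}" by auto
  then show ?thesis by (simp add: linear_ext_def)
qed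

lemma linear_ext_nth_1:
  "fps_nth (linear_ext \<phi> x) 1 = \<phi> 1 (fps_nth x 0) + \<phi> 0 (fps_nth x 1)"
proof -
  have "{(i, j). i + j = (1::nat)} = {(1, 0), (0, 1)}" by auto
  then show ?thesis by (simp add: linear_ext_def)
qed

lemma bilinear_ext_nth_0:
  "fps_nth (bilinear_ext f x y) 0 = f 0 (fps_nth x 0) (fps_nth y 0)"
proof -
  have "{(i, j, k). i + j + k = (0::nat)} = {(0, 0, 0)}" by auto
  then show ?thesis by (simp add: bilinear_ext_def)
qed

text \<open>Total degree 1 leaves three ways to place the single power of \<open>t\<close>: on the
  map or on either argument. On constant series only the first survives; in a nested product the
  other two pick up the first-order part of the inner product.\<close>

lemma bilinear_ext_nth_1:
  "fps_nth (bilinear_ext f x y) 1 =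
     f 1 (fps_nth x 0) (fps_nth y 0) + f 0 (fps_nth x 1) (fps_nth y 0)
       + f 0 (fps_nth x 0) (fps_nth y 1)"
proof -
  have "{(i, j, k). i + j + k = (1::nat)} = {(1, 0, 0), (0, 1, 0), (0, 0, 1)}" by auto
  then show ?thesis by (simp add: bilinear_ext_def)
qed

lemmas ext_nth = linear_ext_nth_0 linear_ext_nth_1 bilinear_ext_nth_0 bilinear_ext_nth_1

lemma module_bilinear_simps:
  assumes "module_bilinear s f"
  shows "f (x + y) z = f x z + f y z" "f x (y + z) = f x y + f x z"
    "f (x - y) z = f x z - f y z" "f x (y - z) = f x y - f x z"
    "f 0 z = 0" "f x 0 = 0"
proof -
  have l: "module_hom s s (\<lambda>x. f x z)" and r: "module_hom s s (f x)" for x z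
    using assms by (auto simp: module_bilinear_def)
  show "f (x + y) z = f x z + f y z" "f x (y + z) = f x y + f x z"
    "f (x - y) z = f x z - f y z" "f x (y - z) = f x y - f x z"
    "f 0 z = 0" "f x 0 = 0"
    using module_hom.add[OF l] module_hom.add[OF r] module_hom.diff[OF l]
      module_hom.diff[OF r] module_hom.zero[OF l] module_hom.zero[OF r]
    by blast+
qed

text \<open>Polarisation: expand \<open>f (x + y) (x + y) = 0\<close> and cancel the two
  squares.\<close>

lemma alternating_imp_antisym:
  assumes "module_bilinear s f" and alt: "\<And>x. f x x = 0"
  shows "f y x = - f x y"
proof -
  have "f y x + f x y = 0"
    using alt[of "x + y"] unfolding module_bilinear_simps[OF assms(1)] by (simp add: alt)
  then show ?thesis by (simp only: eq_neg_iff_add_eq_0)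
qed

lemma infinitesimal_in_PL_cocycles2:
  assumes "formal_post_lie_deformation prd \<pi> \<omega>"
  shows "infinitesimal \<pi> \<omega> \<in> PL_cocycles2 prd"
proof -
  from assms have coch: "(\<pi> i, \<omega> i) \<in> PL_cochains2" for i
    by (simp add: formal_post_lie_deformation_def)
  from assms have \<pi>0: "\<pi> 0 = (\<lambda>x y. 0)" and \<omega>0: "\<omega> 0 = prd"
    by (simp_all add: formal_post_lie_deformation_def)
  have bil\<pi>: "module_bilinear scaleR (\<pi> i)" and bil\<omega>: "module_bilinear scaleR (\<omega> i)"
    and alt: "\<pi> i x x = 0" for i x
    using coch[of i] by (simp_all add: PL_cochains2_def)
  \<comment> \<open>Bilinearity of \<open>prd\<close> is read off from
    \<open>\<omega> 0\<close>.\<close>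
  note s = module_bilinear_simps[OF bil\<pi>] module_bilinear_simps[OF bil\<omega>]
    module_bilinear_simps[OF bil\<omega>[of 0, unfolded \<omega>0]]
  interpret post_lie_algebra fps_scale "bilinear_ext \<pi>" "bilinear_ext \<omega>"
    using assms by (simp add: formal_post_lie_deformation_def)
  \<comment> \<open>Every term pairing \<open>\<omega> 1\<close> with \<open>\<pi> 0\<close>
    vanishes, so at first order only \<open>\<pi> 1\<close> combined with \<open>prd\<close>
    remains.\<close>
  have 1: "prd x (\<pi> 1 y z) = \<pi> 1 (prd x y) z + \<pi> 1 y (prd x z)" for x y z
    using arg_cong[OF prd_derivation[of "fps_const x" "fps_const y" "fps_const z"],
        of "\<lambda>u. fps_nth u 1"]
    by (simp only: fps_add_nth ext_nth \<pi>0 \<omega>0) (simp add: s)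
  \<comment> \<open>Each composite contributes twice, the factor \<open>t\<close> coming from the
    outer product or from the inner operation; the inner bracket has no constant term.\<close>
  have 2: "\<omega> 1 (prd x y - prd y x) z + prd (\<pi> 1 x y + \<omega> 1 x y - \<omega> 1 y x) z
      = \<omega> 1 x (prd y z) + prd x (\<omega> 1 y z) - (\<omega> 1 y (prd x z) + prd y (\<omega> 1 x z))" for x y z
    using arg_cong[OF prd_bracket[of "fps_const x" "fps_const y" "fps_const z"],
        of "\<lambda>u. fps_nth u 1"]
    by (simp only: fps_add_nth fps_sub_nth ext_nth \<pi>0 \<omega>0) (simp add: s algebra_simps)
  \<comment> \<open>The cochain formula has \<open>prd x z\<close> in the first slot of
    \<open>\<pi> 1\<close>, the derivation rule has it in the second; antisymmetry supplies the
    sign.\<close>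
  have "prd x (\<pi> 1 y z) - \<pi> 1 (prd x y) z + \<pi> 1 (prd x z) y = 0" for x y z
    using alternating_imp_antisym[OF bil\<pi> alt, of 1 y "prd x z"] unfolding 1 by simp
  moreover have "- prd (\<omega> 1 x y - \<omega> 1 y x + \<pi> 1 x y) z - \<omega> 1 (prd x y - prd y x) z
      + \<omega> 1 x (prd y z) + prd x (\<omega> 1 y z) - \<omega> 1 y (prd x z) - prd y (\<omega> 1 x z) = 0" for x y z
    using 2[of x y z] by (simp add: s algebra_simps)
  ultimately have "PL_coboundary2 prd (\<pi> 1, \<omega> 1) = 0"
    by (simp add: PL_coboundary2_def zero_prod_def fun_eq_iff)
  with coch[of 1] show ?thesis
    by (simp add: PL_cocycles2_def infinitesimal_def)
qed

lemma formal_isomorphism_imp_PL_cohomologous2: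
  assumes D': "formal_post_lie_deformation prd \<pi>' \<omega>'"
    and D: "formal_post_lie_deformation prd \<pi> \<omega>"
    and iso: "formal_isomorphism \<phi> (\<pi>', \<omega>') (\<pi>, \<omega>)"
  shows "(infinitesimal \<pi>' \<omega>', infinitesimal \<pi> \<omega>) \<in> PL_cohomologous2 prd"
proof -
  have \<pi>0: "\<pi>' 0 = (\<lambda>x y. 0)" "\<pi> 0 = (\<lambda>x y. 0)" and \<omega>0: "\<omega>' 0 = prd" "\<omega> 0 = prd"
    using D D' by (simp_all add: formal_post_lie_deformation_def)
  have lin: "linear (\<phi> i)" and \<phi>0: "\<phi> 0 = id"
    and \<phi>\<pi>: "linear_ext \<phi> (bilinear_ext \<pi>' x y)
      = bilinear_ext \<pi> (linear_ext \<phi> x) (linear_ext \<phi> y)"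
    and \<phi>\<omega>: "linear_ext \<phi> (bilinear_ext \<omega>' x y)
      = bilinear_ext \<omega> (linear_ext \<phi> x) (linear_ext \<phi> y)" for i x y
    using iso by (simp_all add: formal_isomorphism_def)
  have bil: "module_bilinear scaleR (\<omega> 0)" "module_bilinear scaleR (\<omega>' 0)"
    using D D' by (auto simp: formal_post_lie_deformation_def PL_cochains2_def)
  note s = module_bilinear_simps[OF bil(1)[unfolded \<omega>0]]
  \<comment> \<open>At first order \<open>\<phi> 1\<close> only meets the zero brackets
    \<open>\<pi>' 0\<close> and \<open>\<pi> 0\<close>, so the brackets agree, matching the zero
    component of \<open>PL_coboundary1\<close>.\<close>
  have 1: "\<pi>' 1 x y = \<pi> 1 x y" for x y
    using arg_cong[OF \<phi>\<pi>[of "fps_const x" "fps_const y"], of "\<lambda>u. fps_nth u 1"]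
    by (simp only: ext_nth \<pi>0 \<phi>0) (simp add: linear_0[OF lin])
  \<comment> \<open>Here \<open>\<phi> 1\<close> enters three times, outside the product on the left
    and in each argument on the right: these are the three terms of the coboundary.\<close>
  have 2: "\<phi> 1 (prd x y) + \<omega>' 1 x y = \<omega> 1 x y + prd (\<phi> 1 x) y + prd x (\<phi> 1 y)" for x y
    using arg_cong[OF \<phi>\<omega>[of "fps_const x" "fps_const y"], of "\<lambda>u. fps_nth u 1"]
    by (simp only: ext_nth \<omega>0 \<phi>0) (simp add: s)
  have "\<omega>' 1 x y - \<omega> 1 x y = prd (\<phi> 1 x) y + prd x (\<phi> 1 y) - \<phi> 1 (prd x y)" for x y
    using 2[of x y] by (simp add: algebra_simps)
  with 1 have "infinitesimal \<pi>' \<omega>' - infinitesimal \<pi> \<omega> = PL_coboundary1 prd (\<phi> 1)"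
    by (simp add: infinitesimal_def PL_coboundary1_def fun_eq_iff)
  then have "infinitesimal \<pi>' \<omega>' - infinitesimal \<pi> \<omega> \<in> PL_boundaries2 prd"
    using lin by (simp add: PL_boundaries2_def PL_cochains1_def)
  then show ?thesis
    using infinitesimal_in_PL_cocycles2[OF D] infinitesimal_in_PL_cocycles2[OF D']
    by (simp add: PL_cohomologous2_def)
qed

theorem theorem3p12:
  fixes prd :: "'g::real_vector \<Rightarrow> 'g \<Rightarrow> 'g"
    and \<pi>' \<omega>' \<pi> \<omega> :: "nat \<Rightarrow> 'g \<Rightarrow> 'g \<Rightarrow> 'g"
  assumes "pre_lie_algebra scaleR prd"
    and "formal_post_lie_deformation prd \<pi>' \<omega>'"
    and "formal_post_lie_deformation prd \<pi> \<omega>"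
    and "equivalent_deformations (\<pi>', \<omega>') (\<pi>, \<omega>)"
  shows "\<exists>C \<in> PL_cohomology2 prd. infinitesimal \<pi>' \<omega>' \<in> C \<and> infinitesimal \<pi> \<omega> \<in> C"
proof -
  note E = equiv_PL_cohomologous2[OF assms(1)]
  \<comment> \<open>The isomorphism may go either way; symmetry of the relation absorbs its
    direction.\<close>
  have rel: "(infinitesimal \<pi>' \<omega>', infinitesimal \<pi> \<omega>) \<in> PL_cohomologous2 prd"
    using assms(4) formal_isomorphism_imp_PL_cohomologous2[OF assms(2,3)]
      formal_isomorphism_imp_PL_cohomologous2[OF assms(3,2)] E
    by (auto simp: equivalent_deformations_def elim!: equivE dest: symD)
  have cocycle: "infinitesimal \<pi>' \<omega>' \<in> PL_cocycles2 prd"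
    by (rule infinitesimal_in_PL_cocycles2[OF assms(2)])
  show ?thesis
  proof
    \<comment> \<open>The common class is the one generated by the first infinitesimal.\<close>
    show "PL_cohomologous2 prd `` {infinitesimal \<pi>' \<omega>'} \<in> PL_cohomology2 prd"
      unfolding PL_cohomology2_def using cocycle by (rule quotientI)
    show "infinitesimal \<pi>' \<omega>' \<in> PL_cohomologous2 prd `` {infinitesimal \<pi>' \<omega>'}
        \<and> infinitesimal \<pi> \<omega> \<in> PL_cohomologous2 prd `` {infinitesimal \<pi>' \<omega>'}"
      using rel equiv_class_self[OF E cocycle] by blast
  qed
qed

end
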